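(* Assume that for every $\hat\lambda\in V_1(B):=\{\lambda\ge 0:\ B^\top\lambda\le 0,\ \mathbf e^\top\lambda\le 1\}$ the feasibility completion linear program $$\max_{\mu\ge 0}\{g^\top\mu:\ G^\top\mu\le -B^\top\hat\lambda\}$$ is feasible and attains an optimum. Then for any real vector $\tilde\lambda$ (a network output, of dimension equal to the number of rows of $B$), the projected multiplier $\hat\lambda=\Pi_{V_1(B)}(\tilde\lambda)$ admits a completion $\hat\mu\in\arg\max_{\mu\ge 0}\{g^\top\mu:\ G^\top\mu\le -B^\top\hat\lambda\}$, and the pair $(\hat\lambda,\hat\mu)$ satisfies $$B^\top\hat\lambda+G^\top\hat\mu\le 0,\quad \hat\lambda\ge 0,\quad \hat\mu\ge 0,\quad \mathbf e^\top\hat\lambda\le 1,$$ i.e. it is feasible for the problem $\max\{d(\bar y)^\top\lambda+g^\top\mu:\ B^\top\lambda+G^\top\mu\le 0,\ \lambda\ge 0,\ \mu\ge 0,\ \mathbf e^\top\lambda\le 1\}$.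
   Context: Data: real matrices $A,B,G$ and real vectors $b,g$ of compatible dimensions; $d(y):=b-Ay$; $\bar y$ is a first-stage vector; $\{x\ge 0:\ Gx\ge g\}$ is assumed nonempty. $\mathbf e$ is the all-ones vector. $\Pi_{V_1(B)}$ denotes (Euclidean) projection onto the polytope $V_1(B)$. The displayed maximization over $(\lambda,\mu)$ is the dual of $F(\bar y):=\min_{x\ge 0,\ t\ge 0}\{t:\ Bx+t\,\mathbf e\ge d(\bar y),\ Gx\ge g\}$. All vector inequalities are componentwise. *)

theory Defs
  imports "HOL-Analysis.Analysis"
begin

(* Throughout, \<le> on real ^ 'n is the library's componentwise order. *)

datatype 'a max_problem = Maximize (objective: "'a \<Rightarrow> real") (constraints: "'a \<Rightarrow> bool")

definition feasible_for :: "'a max_problem \<Rightarrow> 'a \<Rightarrow> bool" where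
  "feasible_for P x \<longleftrightarrow> constraints P x"

definition optimal_for :: "'a max_problem \<Rightarrow> 'a \<Rightarrow> bool" where
  "optimal_for P x \<longleftrightarrow> is_arg_max (objective P) (constraints P) x"

definition all_ones :: "real ^ 'n" where
  "all_ones = (\<chi> i. 1)"

definition V1 :: "real ^ 'n ^ 'm \<Rightarrow> (real ^ 'm) set" where
  "V1 B = {l. 0 \<le> l \<and> transpose B *v l \<le> 0 \<and> all_ones \<bullet> l \<le> 1}"

definition rhs :: "real ^ 'k ^ 'm \<Rightarrow> real ^ 'm \<Rightarrow> real ^ 'k \<Rightarrow> real ^ 'm" where
  "rhs A b y = b - A *v y"

definition completion_lp ::
  "real ^ 'n ^ 'm \<Rightarrow> real ^ 'n ^ 'p \<Rightarrow> real ^ 'p \<Rightarrow> real ^ 'm \<Rightarrow> (real ^ 'p) max_problem" where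
  "completion_lp B G g l =
    Maximize (\<lambda>\<mu>. g \<bullet> \<mu>)
      (\<lambda>\<mu>. 0 \<le> \<mu> \<and> transpose G *v \<mu> \<le> - (transpose B *v l))"

(* The linear programming dual of
   min {t. x \<ge> 0, t \<ge> 0, B x + t e \<ge> d, G x \<ge> g}, with d = rhs A b y;
   l and \<mu> are the multipliers of the two blocks of constraints. *)
definition feasibility_dual ::
  "real ^ 'n ^ 'm \<Rightarrow> real ^ 'n ^ 'p \<Rightarrow> real ^ 'p \<Rightarrow> real ^ 'm
    \<Rightarrow> ((real ^ 'm) \<times> (real ^ 'p)) max_problem" where
  "feasibility_dual B G g d =
    Maximize (\<lambda>(l, \<mu>). d \<bullet> l + g \<bullet> \<mu>)
      (\<lambda>(l, \<mu>). transpose B *v l + transpose G *v \<mu> \<le> 0 \<and> 0 \<le> l \<and> 0 \<le> \<mu>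
        \<and> all_ones \<bullet> l \<le> 1)"

end

theory Submission
  imports Defs
begin

text \<open>
  The set \<open>V1 B\<close> is closed and contains the origin, so the projection onto it is attained and
  \<open>lhat\<close> really lies in \<open>V1 B\<close>. The solvability assumption on the completion programs then applies
  at \<open>lhat\<close>, and every optimal completion is in particular feasible for its program. Its coupling
  constraint, with the \<open>B\<close> term moved to the left-hand side, is the coupling constraint of the
  dual, while the sign and normalization constraints on \<open>lhat\<close> are part of membership in \<open>V1 B\<close>.
\<close>

text \<open>Componentwise, \<open>V1 B\<close> is a finite intersection of closed half-spaces.\<close>

lemma closed_V1: "closed (V1 B)"
proof -
  have "V1 B = (\<Inter>i. {l. 0 \<le> l $ i}) \<inter> (\<Inter>j. {l. (transpose B *v l) $ j \<le> 0})
      \<inter> {l. all_ones \<bullet> l \<le> 1}"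
    by (auto simp: V1_def less_eq_vec_def)
  moreover have "continuous_on UNIV (\<lambda>l. (transpose B *v l) $ j)" for j
    by (intro continuous_on_component matrix_vector_mult_linear_continuous_on)
  ultimately show ?thesis
    by (simp only:) (intro closed_Int closed_INT closed_Collect_le continuous_intros ballI)
qed

lemma zero_in_V1: "0 \<in> V1 B"
  by (simp add: V1_def)

lemma closest_point_in_V1: "closest_point (V1 B) x \<in> V1 B"
  using closed_V1 zero_in_V1 by (blast intro: closest_point_in_set)

lemma optimal_for_imp_feasible_for: "optimal_for P x \<Longrightarrow> feasible_for P x"
  by (simp add: optimal_for_def feasible_for_def is_arg_max_def)

lemma completion_feasible_for_dual:
  assumes "l \<in> V1 B" and "feasible_for (completion_lp B G g l) \<mu>"
  shows "feasible_for (feasibility_dual B G g d) (l, \<mu>)"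
proof -
  have "transpose G *v \<mu> \<le> - (transpose B *v l)"
    using assms(2) by (simp add: feasible_for_def completion_lp_def)
  then have "transpose B *v l + transpose G *v \<mu> \<le> 0"
    by (metis add.commute add_right_mono add.left_inverse)
  then show ?thesis
    using assms by (simp add: feasible_for_def completion_lp_def feasibility_dual_def V1_def)
qed

theorem theorem4:
  fixes A :: "real ^ 'k ^ 'm" and B :: "real ^ 'n ^ 'm" and G :: "real ^ 'n ^ 'p"
    and b :: "real ^ 'm" and g :: "real ^ 'p"
    and ybar :: "real ^ 'k" and ltilde lhat :: "real ^ 'm"
  assumes "{x :: real ^ 'n. 0 \<le> x \<and> g \<le> G *v x} \<noteq> {}"
    and "\<forall>l\<in>V1 B. (\<exists>\<mu>. feasible_for (completion_lp B G g l) \<mu>)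
                 \<and> (\<exists>\<mu>. optimal_for (completion_lp B G g l) \<mu>)"
    and "lhat = closest_point (V1 B) ltilde"
  shows "(\<exists>\<mu>hat. optimal_for (completion_lp B G g lhat) \<mu>hat)
    \<and> (\<forall>\<mu>hat. optimal_for (completion_lp B G g lhat) \<mu>hat \<longrightarrow>
          transpose B *v lhat + transpose G *v \<mu>hat \<le> 0 \<and> 0 \<le> lhat \<and> 0 \<le> \<mu>hat
        \<and> all_ones \<bullet> lhat \<le> 1
        \<and> feasible_for (feasibility_dual B G g (rhs A b ybar)) (lhat, \<mu>hat))"
proof -
  have lhat: "lhat \<in> V1 B"
    using assms(3) closest_point_in_V1 by simp
  have "feasible_for (feasibility_dual B G g (rhs A b ybar)) (lhat, \<mu>hat)"
    if "optimal_for (completion_lp B G g lhat) \<mu>hat" for \<mu>hat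
    using lhat optimal_for_imp_feasible_for[OF that] by (rule completion_feasible_for_dual)
  then show ?thesis
    using assms(2) lhat by (auto simp: feasible_for_def feasibility_dual_def)
qed

end
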